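(* Let $\rho=\sum_{i=1}^kq_i\rho_i$ be a piecewise continuous probability measure in mixture form on $(E_X,\mathfrak B)$, with reference measure $\mu=\sum_{i=1}^k\mu_i$, such that $H_\mu(\rho)$ is finite. Let $H(X|Y)=\sum_{i=1}^kq_iH_{\mu_i}(\rho_i)$. Let $(A^{(n)}_{\delta'})_{\delta'>0,\,n\in\mathbb N}$ be a family of sets $A^{(n)}_{\delta'}\subset W^{(n)}_{\delta'}(\pi_*\rho)\subset E_Y^n$ such that for all $\delta'>0$, $\epsilon>0$ one has $(\pi_*\rho)^{\otimes n}(A^{(n)}_{\delta'})\ge1-\epsilon$ for all sufficiently large $n$. For any $\delta,\delta'>0$, any $n\in\mathbb N$ with $n\geq 1$, and any $\mathbf y\in A^{(n)}_{\delta'}$, the doubly typical stratum $T^{(n)}_{\delta,\delta'}(\mathbf y)=(\pi^{\times n})^{-1}(\mathbf y)\cap W^{(n)}_\delta(\rho)$ satisfies $$\mu^{\otimes n}\big(T^{(n)}_{\delta,\delta'}(\mathbf y)\big)\le\exp\big(nH(X|Y)+n(\delta+\delta')\big).$$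
   Context: $\mu\llcorner A$ denotes the restricted measure $B\mapsto\mu(A\cap B)$. A measure $\rho$ on $(E_X,\mathfrak B)$ is piecewise continuous if for some integer $k\ge1$ there are pairwise disjoint sets $E_1,\dots,E_k\in\mathfrak B$ and $\sigma$-finite measures $\mu_1,\dots,\mu_k$ on $(E_X,\mathfrak B)$ such that (1) $\mu_i=\mu_i\llcorner E_i$; (2) $\rho(E_i)>0$ for all $i$; (3) $\rho(E_X\setminus\bigcup_iE_i)=0$; (4) $\rho\llcorner E_i\ll\mu_i$. It is assumed that $E_X=\bigcup_iE_i$. Mixture form of a probability $\rho$: $q_i=\rho(E_i)$, $\rho_i=(\rho\llcorner E_i)/q_i$. Put $E_Y=\{1,\dots,k\}$, let $\pi:E_X\to E_Y$ map $E_i$ to $i$, and let $\pi^{\times n}:E_X^n\to E_Y^n$ be the componentwise map; $\pi_*\rho$ has probability mass function $i\mapsto q_i$. For a $\sigma$-finite measure $\nu$ and a probability $\sigma\ll\nu$ with a fixed version $g$ of $d\sigma/d\nu$: $H_\nu(\sigma)=-\int g\ln g\,d\nu$ (finite when $g\ln g$ is $\nu$-integrable), and the weakly typical set $W^{(n)}_\delta(\sigma)$ is the set of $(x_1,\dots,x_n)$ with $|-\frac1n\ln\prod_{i=1}^ng(x_i)-H_\nu(\sigma)|\le\delta$. For $\rho$ the reference measure is $\mu$; for $\pi_*\rho$ it is the counting measure on $E_Y$. *)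

theory Defs
  imports "HOL-Probability.Probability"
begin

definition measure_restr :: "'a measure \<Rightarrow> 'a set \<Rightarrow> 'a measure" where
  "measure_restr M A = measure_of (space M) (sets M) (\<lambda>B. emeasure M (A \<inter> B))"

lemma space_measure_restr [simp]: "space (measure_restr M A) = space M"
  and sets_measure_restr [simp]: "sets (measure_restr M A) = sets M"
  by (simp_all add: measure_restr_def)

lemma emeasure_measure_restr:
  fixes M :: "'a measure"
  assumes "A \<in> sets M" "B \<in> sets M"
  shows "emeasure (measure_restr M A) B = emeasure M (A \<inter> B)"
  unfolding measure_restr_def
proof (rule emeasure_measure_of_sigma)
  show "sigma_algebra (space M) (sets M)" ..
  show "positive (sets M) (\<lambda>B. emeasure M (A \<inter> B))" by (simp add: positive_def)
  show "countably_additive (sets M) (\<lambda>B. emeasure M (A \<inter> B))"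
  proof (rule countably_additiveI)
    fix F :: "nat \<Rightarrow> 'a set"
    assume F: "range F \<subseteq> sets M" "disjoint_family F"
    have "(\<Sum>i. emeasure M (A \<inter> F i)) = emeasure M (\<Union>i. A \<inter> F i)"
      using F assms(1) by (intro suminf_emeasure) (auto simp: disjoint_family_on_def)
    then show "(\<Sum>i. emeasure M (A \<inter> F i)) = emeasure M (A \<inter> (\<Union>i. F i))" by simp
  qed
qed (use assms in auto)

text \<open>The argument \<open>M\<close> only supplies the underlying measurable space.\<close>

definition sum_measure :: "'a measure \<Rightarrow> 'i set \<Rightarrow> ('i \<Rightarrow> 'a measure) \<Rightarrow> 'a measure" where
  "sum_measure M I \<mu> = measure_of (space M) (sets M) (\<lambda>B. \<Sum>i\<in>I. emeasure (\<mu> i) B)"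

lemma space_sum_measure [simp]: "space (sum_measure M I \<mu>) = space M"
  and sets_sum_measure [simp]: "sets (sum_measure M I \<mu>) = sets M"
  by (simp_all add: sum_measure_def)

lemma emeasure_sum_measure:
  fixes M :: "'a measure"
  assumes "\<And>i. i \<in> I \<Longrightarrow> sets (\<mu> i) = sets M" "B \<in> sets M"
  shows "emeasure (sum_measure M I \<mu>) B = (\<Sum>i\<in>I. emeasure (\<mu> i) B)"
  unfolding sum_measure_def
proof (rule emeasure_measure_of_sigma)
  show "sigma_algebra (space M) (sets M)" ..
  show "positive (sets M) (\<lambda>B. \<Sum>i\<in>I. emeasure (\<mu> i) B)" by (simp add: positive_def)
  show "countably_additive (sets M) (\<lambda>B. \<Sum>i\<in>I. emeasure (\<mu> i) B)"
  proof (rule countably_additiveI)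
    fix F :: "nat \<Rightarrow> 'a set"
    assume F: "range F \<subseteq> sets M" "disjoint_family F"
    have "(\<Sum>n. \<Sum>i\<in>I. emeasure (\<mu> i) (F n)) = (\<Sum>i\<in>I. \<Sum>n. emeasure (\<mu> i) (F n))"
      by (rule suminf_sum) simp
    also have "\<dots> = (\<Sum>i\<in>I. emeasure (\<mu> i) (\<Union>n. F n))"
      using F assms(1) by (intro sum.cong refl suminf_emeasure) auto
    finally show "(\<Sum>n. \<Sum>i\<in>I. emeasure (\<mu> i) (F n)) = (\<Sum>i\<in>I. emeasure (\<mu> i) (\<Union>n. F n))" .
  qed
qed (use assms in auto)

text \<open>
  \<open>piecewise_continuous k E \<mu> \<rho>\<close>: the measure \<open>\<rho>\<close> is piecewise continuous, as witnessed by
  the pieces \<open>E 1, \<dots>, E k\<close> and the \<open>\<sigma>\<close>-finite measures \<open>\<mu> 1, \<dots>, \<mu> k\<close>. The ambient measurable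
  space is \<open>(space \<rho>, sets \<rho>)\<close>.
\<close>

definition piecewise_continuous ::
  "nat \<Rightarrow> (nat \<Rightarrow> 'a set) \<Rightarrow> (nat \<Rightarrow> 'a measure) \<Rightarrow> 'a measure \<Rightarrow> bool" where
  "piecewise_continuous k E \<mu> \<rho> \<longleftrightarrow>
     1 \<le> k \<and>
     disjoint_family_on E {1..k} \<and>
     (\<forall>i\<in>{1..k}. E i \<in> sets \<rho>) \<and>
     (\<forall>i\<in>{1..k}. sets (\<mu> i) = sets \<rho> \<and> sigma_finite_measure (\<mu> i)) \<and>
     (\<forall>i\<in>{1..k}. \<mu> i = measure_restr (\<mu> i) (E i)) \<and>
     (\<forall>i\<in>{1..k}. 0 < emeasure \<rho> (E i)) \<and>
     emeasure \<rho> (space \<rho> - (\<Union>i\<in>{1..k}. E i)) = 0 \<and>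
     (\<forall>i\<in>{1..k}. absolutely_continuous (\<mu> i) (measure_restr \<rho> (E i)))"

definition piece_measure :: "'a measure \<Rightarrow> (nat \<Rightarrow> 'a set) \<Rightarrow> nat \<Rightarrow> 'a measure" where
  "piece_measure \<rho> E i = scale_measure (1 / emeasure \<rho> (E i)) (measure_restr \<rho> (E i))"

definition piece_index :: "nat \<Rightarrow> (nat \<Rightarrow> 'a set) \<Rightarrow> 'a \<Rightarrow> nat" where
  "piece_index k E x = (THE i. i \<in> {1..k} \<and> x \<in> E i)"

definition index_distr :: "nat \<Rightarrow> (nat \<Rightarrow> 'a set) \<Rightarrow> 'a measure \<Rightarrow> nat measure" where
  "index_distr k E \<rho> = distr \<rho> (count_space {1..k}) (piece_index k E)"

text \<open>
  \<open>density_version \<nu> \<sigma> g\<close>: \<open>g\<close> is a nonnegative real-valued version of the Radon--Nikodym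
  derivative of \<open>\<sigma>\<close> with respect to \<open>\<nu>\<close>. Typical sets depend on the version; it is therefore
  passed explicitly instead of being fixed to \<^const>\<open>RN_deriv\<close>.
\<close>

definition density_version :: "'a measure \<Rightarrow> 'a measure \<Rightarrow> ('a \<Rightarrow> real) \<Rightarrow> bool" where
  "density_version \<nu> \<sigma> g \<longleftrightarrow>
     g \<in> borel_measurable \<nu> \<and> (\<forall>x\<in>space \<nu>. 0 \<le> g x) \<and> density \<nu> (\<lambda>x. ennreal (g x)) = \<sigma>"

text \<open>
  For a version \<open>g\<close> of \<open>d\<sigma>/d\<nu>\<close> the following two definitions give \<open>H\<^sub>\<nu>(\<sigma>)\<close> and its finiteness.
\<close>

definition gen_entropy :: "'a measure \<Rightarrow> ('a \<Rightarrow> real) \<Rightarrow> real" where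
  "gen_entropy \<nu> g = - (\<integral>x. g x * ln (g x) \<partial>\<nu>)"

definition finite_gen_entropy :: "'a measure \<Rightarrow> ('a \<Rightarrow> real) \<Rightarrow> bool" where
  "finite_gen_entropy \<nu> g \<longleftrightarrow> integrable \<nu> (\<lambda>x. g x * ln (g x))"

text \<open>
  A point where the product density vanishes has \<open>-ln 0 = \<infinity>\<close> and is never typical; since
  \<open>ln 0 = 0\<close> in HOL, such points have to be excluded explicitly.
\<close>

definition typical_set :: "'a measure \<Rightarrow> ('a \<Rightarrow> real) \<Rightarrow> nat \<Rightarrow> real \<Rightarrow> (nat \<Rightarrow> 'a) set" where
  "typical_set \<nu> g n \<delta> =
     {x \<in> space (\<Pi>\<^sub>M i\<in>{..<n}. \<nu>).
        0 < (\<Prod>i<n. g (x i)) \<and>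
        \<bar>- (1 / real n) * ln (\<Prod>i<n. g (x i)) - gen_entropy \<nu> g\<bar> \<le> \<delta>}"

text \<open>\<open>H(X|Y)\<close>, where \<open>f i\<close> is a version of the density of the \<open>i\<close>-th component of \<open>\<rho>\<close>.\<close>

definition conditional_gen_entropy ::
  "nat \<Rightarrow> (nat \<Rightarrow> 'a set) \<Rightarrow> (nat \<Rightarrow> 'a measure) \<Rightarrow> 'a measure \<Rightarrow> (nat \<Rightarrow> 'a \<Rightarrow> real) \<Rightarrow> real" where
  "conditional_gen_entropy k E \<mu> \<rho> f =
     (\<Sum>i=1..k. measure \<rho> (E i) * gen_entropy (\<mu> i) (f i))"

text \<open>The tolerance \<open>\<delta>'\<close> enters the stratum only through the choice of \<open>y\<close>.\<close>

definition doubly_typical_stratum ::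
  "nat \<Rightarrow> (nat \<Rightarrow> 'a set) \<Rightarrow> 'a measure \<Rightarrow> ('a \<Rightarrow> real) \<Rightarrow> nat \<Rightarrow> real \<Rightarrow> (nat \<Rightarrow> nat) \<Rightarrow> (nat \<Rightarrow> 'a) set"
  where
  "doubly_typical_stratum k E \<nu> g n \<delta> y =
     {x \<in> space (\<Pi>\<^sub>M i\<in>{..<n}. \<nu>). (\<lambda>i\<in>{..<n}. piece_index k E (x i)) = y}
       \<inter> typical_set \<nu> g n \<delta>"

end

theory Submission imports Defs begin

text \<open>
  The entropy bound comes from evaluating the probability of a stratum in two ways. On it the
  product density is at least \<open>exp (- n (H\<^sub>\<mu>(\<rho>) + \<delta>))\<close>, while it is contained in the product of the
  pieces \<open>E (y i)\<close>, whose probability is at most \<open>exp (- n (H(Y) - \<delta>'))\<close> because \<open>y\<close> is typical.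
  Hence its \<open>\<mu>\<close>-volume is at most \<open>exp (n (H\<^sub>\<mu>(\<rho>) - H(Y) + \<delta> + \<delta>'))\<close>, and the chain rule
  \<open>H\<^sub>\<mu>(\<rho>) = H(Y) + H(X|Y)\<close> concludes. The chain rule holds since each \<open>\<mu> i\<close> is the restriction
  of \<open>\<mu>\<close> to \<open>E i\<close>, so that the density of the \<open>i\<close>-th component is \<open>g / q i\<close> almost everywhere.
\<close>

section \<open>Calculus of densities: restriction, scaling, finite products\<close>

text \<open>Turns every restriction below into a density, so that restricting and changing the
  reference measure become multiplications of functions.\<close>

lemma measure_restr_eq_density:
  assumes "A \<in> sets M"
  shows "measure_restr M A = density M (indicator A)"
proof (rule measure_eqI)
  fix B assume "B \<in> sets (measure_restr M A)"
  then show "emeasure (measure_restr M A) B = emeasure (density M (indicator A)) B"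
    using assms
    by (simp add: emeasure_measure_restr emeasure_density flip: indicator_inter_arith)
qed simp

lemma scale_measure_density:
  assumes "f \<in> borel_measurable M"
  shows "scale_measure c (density M f) = density M (\<lambda>x. c * f x)"
  using assms
  by (intro measure_eqI) (auto simp: emeasure_density nn_integral_cmult mult.assoc)

text \<open>A product of \<sigma>-finite measures is determined by its values on boxes, and over a
  box the integral of a product of one-coordinate functions factors. The densities are assumed
  \<sigma>-finite separately, since a factor \<open>g i\<close> with infinite values could destroy
  this property.\<close>

lemma PiM_density:
  fixes M :: "'i \<Rightarrow> 'a measure" and g :: "'i \<Rightarrow> 'a \<Rightarrow> ennreal"
  assumes "finite I"
    and "\<And>i. sigma_finite_measure (M i)"
    and "\<And>i. sigma_finite_measure (density (M i) (g i))"
    and g[measurable]: "\<And>i. g i \<in> borel_measurable (M i)"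
  shows "PiM I (\<lambda>i. density (M i) (g i)) = density (PiM I M) (\<lambda>x. \<Prod>i\<in>I. g i (x i))"
proof -
  interpret M: product_sigma_finite M
    using assms(2) by (simp add: product_sigma_finite_def)
  interpret N: product_sigma_finite "\<lambda>i. density (M i) (g i)"
    using assms(3) by (simp add: product_sigma_finite_def)
  have [measurable]: "(\<lambda>x. \<Prod>i\<in>I. g i (x i)) \<in> borel_measurable (PiM I M)"
    by (intro borel_measurable_prod_ennreal) measurable
  show ?thesis
  proof (rule N.PiM_eqI[symmetric])
    show "sets (density (PiM I M) (\<lambda>x. \<Prod>i\<in>I. g i (x i))) = sets (PiM I (\<lambda>i. density (M i) (g i)))"
      by (auto intro!: sets_PiM_cong)
  next
    fix A assume "\<And>i. i \<in> I \<Longrightarrow> A i \<in> sets (density (M i) (g i))"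
    then have A[measurable]: "\<And>i. i \<in> I \<Longrightarrow> A i \<in> sets (M i)" by simp
    have [measurable]: "Pi\<^sub>E I A \<in> sets (PiM I M)"
      using A \<open>finite I\<close> by (intro sets_PiM_I_finite) auto
    have "emeasure (density (PiM I M) (\<lambda>x. \<Prod>i\<in>I. g i (x i))) (Pi\<^sub>E I A)
        = (\<integral>\<^sup>+x. (\<Prod>i\<in>I. g i (x i)) * indicator (Pi\<^sub>E I A) x \<partial>PiM I M)"
      by (simp add: emeasure_density)
    also have "\<dots> = (\<integral>\<^sup>+x. (\<Prod>i\<in>I. g i (x i) * indicator (A i) (x i)) \<partial>PiM I M)"
    proof (rule nn_integral_cong)
      fix x assume "x \<in> space (PiM I M)"
      \<comment> \<open>A point of the product space is already extensional, so it can leave the box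
        only through some coordinate in \<open>I\<close>, which makes one factor zero.\<close>
      then have "indicator (Pi\<^sub>E I A) x = (\<Prod>i\<in>I. indicator (A i) (x i) :: ennreal)"
        using \<open>finite I\<close>
        by (cases "x \<in> Pi\<^sub>E I A") (auto simp: space_PiM PiE_iff extensional_def intro!: prod_zero bexI)
      then show "(\<Prod>i\<in>I. g i (x i)) * indicator (Pi\<^sub>E I A) x
          = (\<Prod>i\<in>I. g i (x i) * indicator (A i) (x i))"
        by (simp add: prod.distrib)
    qed
    also have "\<dots> = (\<Prod>i\<in>I. \<integral>\<^sup>+x. g i x * indicator (A i) x \<partial>M i)"
      using \<open>finite I\<close> by (intro M.product_nn_integral_prod) auto
    also have "\<dots> = (\<Prod>i\<in>I. emeasure (density (M i) (g i)) (A i))"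
      by (intro prod.cong) (auto simp: emeasure_density)
    finally show "emeasure (density (PiM I M) (\<lambda>x. \<Prod>i\<in>I. g i (x i))) (Pi\<^sub>E I A)
      = (\<Prod>i\<in>I. emeasure (density (M i) (g i)) (A i))" .
  qed fact
qed

section \<open>The pieces and the reference measure\<close>

locale piecewise_continuous_prob = prob_space \<rho>
  for \<rho> :: "'a measure" +
  fixes k :: nat and E :: "nat \<Rightarrow> 'a set" and \<mu>s :: "nat \<Rightarrow> 'a measure"
  assumes piecewise: "piecewise_continuous k E \<mu>s \<rho>"
    and cover: "space \<rho> = (\<Union>i\<in>{1..k}. E i)"
begin

definition \<nu> :: "'a measure" where
  "\<nu> = sum_measure \<rho> {1..k} \<mu>s"

lemma space_\<nu> [simp]: "space \<nu> = space \<rho>"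
  and sets_\<nu> [simp, measurable_cong]: "sets \<nu> = sets \<rho>"
  by (simp_all add: \<nu>_def)

lemma sets_E [measurable]: "i \<in> {1..k} \<Longrightarrow> E i \<in> sets \<rho>"
  and sets_\<mu>s: "i \<in> {1..k} \<Longrightarrow> sets (\<mu>s i) = sets \<rho>"
  and sigma_finite_\<mu>s: "i \<in> {1..k} \<Longrightarrow> sigma_finite_measure (\<mu>s i)"
  and \<mu>s_restr: "i \<in> {1..k} \<Longrightarrow> \<mu>s i = measure_restr (\<mu>s i) (E i)"
  and disjoint_E: "disjoint_family_on E {1..k}"
  and emeasure_E_pos: "i \<in> {1..k} \<Longrightarrow> 0 < emeasure \<rho> (E i)"
  using piecewise unfolding piecewise_continuous_def by blast+

lemma E_unique: "i \<in> {1..k} \<Longrightarrow> j \<in> {1..k} \<Longrightarrow> x \<in> E i \<Longrightarrow> x \<in> E j \<Longrightarrow> i = j"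
  using disjoint_E by (meson disjoint_family_on_def disjoint_iff)

lemma measure_E_pos: "i \<in> {1..k} \<Longrightarrow> 0 < measure \<rho> (E i)"
  using emeasure_E_pos[of i] by (simp add: emeasure_eq_measure)

lemma emeasure_\<mu>s_Int:
  assumes "i \<in> {1..k}" "B \<in> sets \<rho>"
  shows "emeasure (\<mu>s i) (E i \<inter> B) = emeasure (\<mu>s i) B"
  using assms \<mu>s_restr[of i] emeasure_measure_restr[of "E i" "\<mu>s i" B] sets_E[of i]
  by (simp add: sets_\<mu>s)

text \<open>Each \<open>\<mu>s j\<close> is concentrated on \<open>E j\<close>, and the pieces are
  disjoint, so inside \<open>E i\<close> only the summand \<open>\<mu>s i\<close>
  contributes.\<close>

lemma emeasure_\<nu>_Int:
  assumes i: "i \<in> {1..k}" and B: "B \<in> sets \<rho>"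
  shows "emeasure \<nu> (E i \<inter> B) = emeasure (\<mu>s i) B"
proof -
  have "emeasure (\<mu>s j) (E i \<inter> B) = 0" if j: "j \<in> {1..k}" "j \<noteq> i" for j
  proof -
    have "E j \<inter> (E i \<inter> B) = {}"
      using E_unique i j by blast
    then show ?thesis
      using emeasure_\<mu>s_Int[OF j(1), of "E i \<inter> B"] sets_E[OF i] B by simp
  qed
  then have "(\<Sum>j\<in>{1..k}. emeasure (\<mu>s j) (E i \<inter> B)) = (\<Sum>j\<in>{i}. emeasure (\<mu>s j) (E i \<inter> B))"
    using i by (intro sum.mono_neutral_right) auto
  then show ?thesis
    using B sets_E[OF i] emeasure_\<mu>s_Int[OF i B] emeasure_sum_measure[of "{1..k}" \<mu>s \<rho> "E i \<inter> B"]
    by (simp add: \<nu>_def sets_\<mu>s)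
qed

lemma \<mu>s_eq_density:
  assumes "i \<in> {1..k}"
  shows "\<mu>s i = density \<nu> (indicator (E i))"
proof -
  have "\<mu>s i = measure_restr \<nu> (E i)"
    using assms sets_E[OF assms]
    by (intro measure_eqI)
      (auto simp: sets_\<mu>s emeasure_measure_restr emeasure_\<nu>_Int)
  then show ?thesis
    using sets_E[OF assms] by (simp add: measure_restr_eq_density)
qed

text \<open>Needed to form powers of \<open>\<nu>\<close>. On \<open>E i\<close> the measure
  \<open>\<nu>\<close> agrees with \<open>\<mu>s i\<close>, so a countable cover by sets of finite
  \<open>\<mu>s i\<close>-measure, cut down to \<open>E i\<close>, has finite
  \<open>\<nu>\<close>-measure; the finitely many pieces cover the space.\<close>

lemma sigma_finite_\<nu>: "sigma_finite_measure \<nu>"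
proof -
  have "\<exists>C. countable C \<and> C \<subseteq> sets (\<mu>s i) \<and> \<Union>C = space (\<mu>s i) \<and> (\<forall>a\<in>C. emeasure (\<mu>s i) a \<noteq> \<infinity>)"
    if "i \<in> {1..k}" for i
    using sigma_finite_\<mu>s[OF that] unfolding sigma_finite_measure_def by auto
  then obtain C where C: "\<And>i. i \<in> {1..k} \<Longrightarrow> countable (C i)"
    "\<And>i. i \<in> {1..k} \<Longrightarrow> C i \<subseteq> sets (\<mu>s i)"
    "\<And>i. i \<in> {1..k} \<Longrightarrow> \<Union>(C i) = space (\<mu>s i)"
    "\<And>i a. i \<in> {1..k} \<Longrightarrow> a \<in> C i \<Longrightarrow> emeasure (\<mu>s i) a \<noteq> \<infinity>"
    by metis
  have sp: "space (\<mu>s i) = space \<rho>" if "i \<in> {1..k}" for i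
    using sets_\<mu>s[OF that] by (rule sets_eq_imp_space_eq)
  let ?D = "\<Union>i\<in>{1..k}. (\<lambda>a. E i \<inter> a) ` C i"
  have 1: "countable ?D" using C(1) by (intro countable_UN countable_image) auto
  have 2: "?D \<subseteq> sets \<nu>"
    using C(2) sets_E sets_\<mu>s by (fastforce intro!: sets.Int)
  have "\<Union>?D = (\<Union>i\<in>{1..k}. E i \<inter> \<Union>(C i))" by auto
  also have "\<dots> = (\<Union>i\<in>{1..k}. E i \<inter> space \<rho>)"
    by (intro SUP_cong refl) (simp only: C(3) sp)
  also have "\<dots> = space \<nu>" using cover by auto
  finally have 3: "\<Union>?D = space \<nu>" .
  have 4: "\<forall>a\<in>?D. emeasure \<nu> a \<noteq> \<infinity>"
    using C(2,4) sets_\<mu>s by (auto simp: emeasure_\<nu>_Int subset_eq)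
  show ?thesis
    by standard (use 1 2 3 4 in blast)
qed

lemma sum_indicator_E:
  assumes "x \<in> space \<rho>"
  shows "(\<Sum>i=1..k. indicator (E i) x) = (1::real)"
proof -
  obtain i where i: "i \<in> {1..k}" "x \<in> E i" using assms cover by auto
  have "(\<Sum>j=1..k. indicator (E j) x) = (\<Sum>j\<in>{i}. indicator (E j) x :: real)"
  proof (rule sum.mono_neutral_right)
    show "\<forall>j\<in>{1..k} - {i}. indicator (E j) x = (0::real)"
      using E_unique i by (metis DiffE indicator_simps(2) singletonI)
  qed (use i in auto)
  then show ?thesis using i by simp
qed

text \<open>The indicators of the pieces form a partition of unity, and multiplying by one of them
  amounts to integrating against the corresponding \<open>\<mu>s i\<close>.\<close>

lemma
  fixes \<phi> :: "'a \<Rightarrow> real"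
  assumes \<phi>: "integrable \<nu> \<phi>"
  shows integrable_\<mu>s: "i \<in> {1..k} \<Longrightarrow> integrable (\<mu>s i) \<phi>"
    and integral_\<nu>: "(\<integral>x. \<phi> x \<partial>\<nu>) = (\<Sum>i=1..k. \<integral>x. \<phi> x \<partial>\<mu>s i)"
proof -
  have d: "\<mu>s i = density \<nu> (\<lambda>x. ennreal (indicator (E i) x))" if "i \<in> {1..k}" for i
    using \<mu>s_eq_density[OF that] by (simp add: ennreal_indicator)
  have m: "\<phi> \<in> borel_measurable \<nu>" using \<phi> by auto
  have E: "E i \<in> sets \<nu>" if "i \<in> {1..k}" for i using sets_E[OF that] by simp
  have int: "integrable \<nu> (\<lambda>x. indicator (E i) x * \<phi> x)" if "i \<in> {1..k}" for i
    using integrable_mult_indicator[OF E[OF that] \<phi>] by simp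
  show "integrable (\<mu>s i) \<phi>" if "i \<in> {1..k}" for i
    using int[OF that] m E[OF that] by (simp add: d[OF that] integrable_density)
  have "(\<integral>x. \<phi> x \<partial>\<nu>) = (\<integral>x. (\<Sum>i=1..k. indicator (E i) x * \<phi> x) \<partial>\<nu>)"
    by (intro Bochner_Integration.integral_cong refl)
      (simp only: sum_indicator_E space_\<nu> mult_1 flip: sum_distrib_right)
  also have "\<dots> = (\<Sum>i=1..k. \<integral>x. indicator (E i) x * \<phi> x \<partial>\<nu>)"
    using int by (intro Bochner_Integration.integral_sum) auto
  also have "\<dots> = (\<Sum>i=1..k. \<integral>x. \<phi> x \<partial>\<mu>s i)"
    using m E by (intro sum.cong refl) (simp add: d integral_density)
  finally show "(\<integral>x. \<phi> x \<partial>\<nu>) = (\<Sum>i=1..k. \<integral>x. \<phi> x \<partial>\<mu>s i)" .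
qed

section \<open>The projection to piece indices and its law\<close>

lemma piece_index_eq:
  assumes "i \<in> {1..k}" "x \<in> E i"
  shows "piece_index k E x = i"
  unfolding piece_index_def
  using assms E_unique by (intro the_equality) blast+

lemma piece_index_in:
  assumes "x \<in> space \<rho>"
  shows "piece_index k E x \<in> {1..k}" "x \<in> E (piece_index k E x)"
  using assms cover piece_index_eq by auto

lemma piece_index_measurable [measurable]:
  "piece_index k E \<in> measurable \<rho> (count_space {1..k})"
proof (rule measurable_count_space_eq_countable[THEN iffD2], simp, intro conjI ballI)
  show "piece_index k E \<in> space \<rho> \<rightarrow> {1..k}" using piece_index_in by auto
  fix i assume i: "i \<in> {1..k}"
  have "piece_index k E -` {i} \<inter> space \<rho> = E i"
    using piece_index_in piece_index_eq i cover by auto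
  then show "piece_index k E -` {i} \<inter> space \<rho> \<in> sets \<rho>" using sets_E[OF i] by simp
qed

text \<open>The counting measure has no nonempty null sets, so a density is forced at every point;
  evaluating on the singleton of \<open>i\<close> gives the mass of the fibre
  \<open>E i\<close>.\<close>

lemma density_version_index_distr:
  assumes h: "density_version (count_space {1..k}) (index_distr k E \<rho>) h" and i: "i \<in> {1..k}"
  shows "h i = measure \<rho> (E i)"
proof -
  have vi: "piece_index k E -` {i} \<inter> space \<rho> = E i"
    using piece_index_in piece_index_eq i cover by auto
  have "ennreal (h i) = emeasure (density (count_space {1..k}) h) {i}"
    using i by (simp add: emeasure_density nn_integral_count_space_finite indicator_def if_distrib cong: if_cong)
  also have "\<dots> = emeasure \<rho> (E i)"
    using h i vi emeasure_distr[OF piece_index_measurable, of "{i}"]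
    by (simp add: density_version_def index_distr_def)
  finally show ?thesis
    using h i by (simp add: emeasure_eq_measure density_version_def)
qed

section \<open>Component densities and the entropy chain rule\<close>

context
  fixes g :: "'a \<Rightarrow> real"
  assumes g: "density_version \<nu> \<rho> g"
begin

lemma g_measurable: "g \<in> borel_measurable \<rho>"
  and g_nonneg: "x \<in> space \<rho> \<Longrightarrow> 0 \<le> g x"
  and density_g: "density \<nu> g = \<rho>"
  using g by (auto simp: density_version_def measurable_cong_sets[OF sets_\<nu> refl])

lemma integrable_g: "integrable \<nu> g"
proof -
  have "integrable (density \<nu> g) (\<lambda>_. 1::real)" by (simp add: density_g)
  then show ?thesis
    using g_measurable g_nonneg by (subst (asm) integrable_density) auto
qed

text \<open>Restriction to \<open>E i\<close> and passage to the density \<open>g\<close> are both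
  multiplications of the integrand, hence commute.\<close>

lemma density_\<mu>s_g:
  assumes i: "i \<in> {1..k}"
  shows "density (\<mu>s i) g = measure_restr \<rho> (E i)"
proof -
  have [measurable]: "g \<in> borel_measurable \<nu>" using g_measurable by simp
  have [measurable]: "E i \<in> sets \<nu>" using sets_E[OF i] by simp
  have "density (\<mu>s i) g = density \<nu> (\<lambda>x. indicator (E i) x * ennreal (g x))"
    by (simp add: \<mu>s_eq_density[OF i] density_density_eq)
  also have "\<dots> = density (density \<nu> g) (indicator (E i))"
    by (simp add: density_density_eq mult.commute)
  also have "\<dots> = measure_restr \<rho> (E i)"
    using sets_E[OF i] by (simp add: density_g measure_restr_eq_density)
  finally show ?thesis .
qed

lemma integral_\<mu>s_g:
  assumes i: "i \<in> {1..k}"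
  shows "(\<integral>x. g x \<partial>\<mu>s i) = measure \<rho> (E i)"
proof -
  have sp: "space (\<mu>s i) = space \<rho>" using sets_\<mu>s[OF i] by (rule sets_eq_imp_space_eq)
  have [measurable]: "g \<in> borel_measurable (\<mu>s i)"
    using g_measurable by (simp add: measurable_cong_sets[OF sets_\<mu>s[OF i] refl])
  have "(\<integral>\<^sup>+x. g x \<partial>\<mu>s i) = emeasure (density (\<mu>s i) g) (space (\<mu>s i))"
    by (simp add: emeasure_density cong: nn_integral_cong)
  also have "\<dots> = emeasure \<rho> (E i)"
    using sets_E[OF i] sp by (simp add: density_\<mu>s_g[OF i] emeasure_measure_restr)
  finally show ?thesis
    using g_nonneg sp by (subst integral_eq_nn_integral) (auto simp: measure_def)
qed

text \<open>Both functions are densities of the normalised piece with respect to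
  \<open>\<mu>s i\<close>, so almost everywhere uniqueness applies. This links the arbitrary version
  \<open>f\<close> to the version \<open>g\<close> of the whole measure.\<close>

lemma AE_piece_density:
  assumes i: "i \<in> {1..k}" and f: "density_version (\<mu>s i) (piece_measure \<rho> E i) f"
  shows "AE x in \<mu>s i. f x = g x / measure \<rho> (E i)"
proof -
  let ?q = "measure \<rho> (E i)"
  have q: "0 < ?q" using measure_E_pos[OF i] .
  have sp: "space (\<mu>s i) = space \<rho>" using sets_\<mu>s[OF i] by (rule sets_eq_imp_space_eq)
  have g'[measurable]: "g \<in> borel_measurable (\<mu>s i)"
    using g_measurable by (simp add: measurable_cong_sets[OF sets_\<mu>s[OF i] refl])
  have f'[measurable]: "f \<in> borel_measurable (\<mu>s i)" and f0: "\<And>x. x \<in> space (\<mu>s i) \<Longrightarrow> 0 \<le> f x"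
    and fd: "density (\<mu>s i) f = piece_measure \<rho> E i"
    using f by (auto simp: density_version_def)
  have e: "ennreal (1 / ?q) = 1 / emeasure \<rho> (E i)"
    using q by (simp add: emeasure_eq_measure divide_ennreal flip: ennreal_1)
  have "density (\<mu>s i) (\<lambda>x. ennreal (g x / ?q)) = density (\<mu>s i) (\<lambda>x. ennreal (1 / ?q) * ennreal (g x))"
    using q g_nonneg sp by (intro density_cong) (auto simp flip: ennreal_mult)
  also have "\<dots> = piece_measure \<rho> E i"
    unfolding piece_measure_def density_\<mu>s_g[OF i, symmetric] e[symmetric]
    by (intro scale_measure_density[symmetric]) measurable
  finally have eq: "density (\<mu>s i) f = density (\<mu>s i) (\<lambda>x. ennreal (g x / ?q))"
    using fd by simp
  \<comment> \<open>Uniqueness of densities is invoked in the form that asks for a finite integral,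
    so the total mass is computed first.\<close>
  have "(\<integral>\<^sup>+x. f x \<partial>\<mu>s i) = emeasure (density (\<mu>s i) f) (space (\<mu>s i))"
    by (simp add: emeasure_density cong: nn_integral_cong)
  also have "\<dots> = ennreal (1 / ?q) * emeasure \<rho> (E i)"
    using sets_E[OF i] sp by (simp add: fd piece_measure_def emeasure_measure_restr e)
  also have "\<dots> \<noteq> \<infinity>" by (simp add: emeasure_eq_measure flip: ennreal_mult)
  finally have "AE x in \<mu>s i. ennreal (f x) = ennreal (g x / ?q)"
    using eq by (intro finite_density_unique[THEN iffD1]) auto
  with AE_space show ?thesis
    by eventually_elim (use f0 g_nonneg sp q in auto)
qed

text \<open>With \<open>q\<close> the mass of the piece and \<open>f = g / q\<close>, the integrand
  \<open>f ln f\<close> splits into \<open>(g ln g) / q\<close> and \<open>(ln q / q) g\<close>, and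
  \<open>g\<close> integrates to \<open>q\<close> over the piece.\<close>

lemma piece_entropy:
  assumes i: "i \<in> {1..k}" and f: "density_version (\<mu>s i) (piece_measure \<rho> E i) f"
    and fin: "finite_gen_entropy \<nu> g"
  shows "measure \<rho> (E i) * gen_entropy (\<mu>s i) f
    = measure \<rho> (E i) * ln (measure \<rho> (E i)) - (\<integral>x. g x * ln (g x) \<partial>\<mu>s i)"
proof -
  let ?q = "measure \<rho> (E i)"
  have q: "0 < ?q" using measure_E_pos[OF i] .
  have sp: "space (\<mu>s i) = space \<rho>" using sets_\<mu>s[OF i] by (rule sets_eq_imp_space_eq)
  have [measurable]: "g \<in> borel_measurable (\<mu>s i)"
    using g_measurable by (simp add: measurable_cong_sets[OF sets_\<mu>s[OF i] refl])
  have [measurable]: "f \<in> borel_measurable (\<mu>s i)" using f by (auto simp: density_version_def)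
  have ints: "integrable (\<mu>s i) g" "integrable (\<mu>s i) (\<lambda>x. g x * ln (g x))"
    using integrable_\<mu>s[OF _ i] integrable_g fin by (auto simp: finite_gen_entropy_def)
  have ae: "AE x in \<mu>s i. f x * ln (f x) = (1 / ?q) * (g x * ln (g x)) - (ln ?q / ?q) * g x"
    using AE_piece_density[OF i f] AE_space
  proof eventually_elim
    case (elim x)
    then have "0 \<le> g x" using g_nonneg sp by auto
    \<comment> \<open>The logarithm of the quotient splits only for positive \<open>g x\<close>;
      where \<open>g x = 0\<close> both sides vanish because of the factor
      \<open>g x\<close>.\<close>
    with q show ?case
      unfolding elim(1) by (cases "g x = 0") (auto simp: ln_div field_simps)
  qed
  have "(\<integral>x. f x * ln (f x) \<partial>\<mu>s i) = (\<integral>x. (1 / ?q) * (g x * ln (g x)) - (ln ?q / ?q) * g x \<partial>\<mu>s i)"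
    by (intro integral_cong_AE ae) measurable
  also have "\<dots> = (1 / ?q) * (\<integral>x. g x * ln (g x) \<partial>\<mu>s i) - (ln ?q / ?q) * ?q"
    using ints by (simp add: integral_\<mu>s_g[OF i])
  finally show ?thesis
    using q by (simp add: gen_entropy_def field_simps)
qed

text \<open>Summing \<open>piece_entropy\<close> over the pieces, the terms \<open>q ln q\<close>
  add up to minus the discrete entropy of the index, and the integrals recombine to the one over
  \<open>\<nu>\<close>.\<close>

theorem entropy_chain_rule:
  assumes "\<And>i. i \<in> {1..k} \<Longrightarrow> density_version (\<mu>s i) (piece_measure \<rho> E i) (f i)"
    and h: "density_version (count_space {1..k}) (index_distr k E \<rho>) h"
    and fin: "finite_gen_entropy \<nu> g"
  shows "gen_entropy \<nu> g
    = gen_entropy (count_space {1..k}) h + conditional_gen_entropy k E \<mu>s \<rho> f"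
proof -
  have "conditional_gen_entropy k E \<mu>s \<rho> f
    = (\<Sum>i=1..k. measure \<rho> (E i) * ln (measure \<rho> (E i)) - (\<integral>x. g x * ln (g x) \<partial>\<mu>s i))"
    unfolding conditional_gen_entropy_def
    using assms by (intro sum.cong refl piece_entropy)
  also have "\<dots> = (\<Sum>i=1..k. measure \<rho> (E i) * ln (measure \<rho> (E i))) - (\<integral>x. g x * ln (g x) \<partial>\<nu>)"
    using fin by (simp add: sum_subtractf integral_\<nu> finite_gen_entropy_def)
  also have "\<dots> = gen_entropy \<nu> g - gen_entropy (count_space {1..k}) h"
    by (simp add: gen_entropy_def lebesgue_integral_count_space_finite density_version_index_distr[OF h])
  finally show ?thesis by simp
qed

section \<open>Product densities and the volume of typical sets\<close>

lemma PiM_\<rho>_eq_density: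
  assumes "finite I"
  shows "PiM I (\<lambda>_. \<rho>) = density (PiM I (\<lambda>_. \<nu>)) (\<lambda>x. ennreal (\<Prod>i\<in>I. g (x i)))"
proof -
  have [measurable]: "g \<in> borel_measurable \<nu>" using g_measurable by simp
  have "PiM I (\<lambda>_. \<rho>) = PiM I (\<lambda>_. density \<nu> g)" by (simp add: density_g)
  also have "\<dots> = density (PiM I (\<lambda>_. \<nu>)) (\<lambda>x. \<Prod>i\<in>I. ennreal (g (x i)))"
    using assms sigma_finite_\<nu> by (intro PiM_density) (auto simp: density_g sigma_finite_measure_axioms)
  also have "\<dots> = density (PiM I (\<lambda>_. \<nu>)) (\<lambda>x. ennreal (\<Prod>i\<in>I. g (x i)))"
  proof (rule density_cong)
    show "AE x in PiM I (\<lambda>_. \<nu>). (\<Prod>i\<in>I. ennreal (g (x i))) = ennreal (\<Prod>i\<in>I. g (x i))"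
      \<comment> \<open>Nonnegativity of \<open>g\<close> is known only on the space, so the product
        is moved inside \<open>ennreal\<close> only at points of the product space.\<close>
      by (rule AE_I2) (auto simp: space_PiM PiE_iff g_nonneg intro!: prod_ennreal)
    show "(\<lambda>x. \<Prod>i\<in>I. ennreal (g (x i))) \<in> borel_measurable (PiM I (\<lambda>_. \<nu>))"
      by (intro borel_measurable_prod_ennreal) measurable
    show "(\<lambda>x. ennreal (\<Prod>i\<in>I. g (x i))) \<in> borel_measurable (PiM I (\<lambda>_. \<nu>))"
      by measurable
  qed
  finally show ?thesis .
qed

text \<open>Typicality bounds the product density from below by a constant on \<open>T\<close>;
  integrating this bound over \<open>T\<close> compares volume with probability.\<close>

lemma emeasure_typical_le:
  assumes T: "T \<subseteq> typical_set \<nu> g n \<delta>" "T \<in> sets (\<Pi>\<^sub>M i\<in>{..<n}. \<nu>)" and n: "1 \<le> n"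
  shows "ennreal (exp (- (real n * (gen_entropy \<nu> g + \<delta>)))) * emeasure (\<Pi>\<^sub>M i\<in>{..<n}. \<nu>) T
    \<le> emeasure (\<Pi>\<^sub>M i\<in>{..<n}. \<rho>) T"
proof -
  have [measurable]: "g \<in> borel_measurable \<nu>" using g_measurable by simp
  let ?c = "exp (- (real n * (gen_entropy \<nu> g + \<delta>)))"
  have le: "?c \<le> (\<Prod>i<n. g (x i))" if "x \<in> T" for x
  proof -
    have pos: "0 < (\<Prod>i<n. g (x i))"
      and "- (1 / real n) * ln (\<Prod>i<n. g (x i)) \<le> gen_entropy \<nu> g + \<delta>"
      using T(1) that by (auto simp: typical_set_def abs_le_iff)
    then have "- (real n * (gen_entropy \<nu> g + \<delta>)) \<le> ln (\<Prod>i<n. g (x i))"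
      using n by (simp add: field_simps)
    then show ?thesis using pos by (metis exp_le_cancel_iff exp_ln)
  qed
  have "ennreal ?c * emeasure (\<Pi>\<^sub>M i\<in>{..<n}. \<nu>) T
    = (\<integral>\<^sup>+x. ennreal ?c * indicator T x \<partial>(\<Pi>\<^sub>M i\<in>{..<n}. \<nu>))"
    using T(2) by (simp add: nn_integral_cmult_indicator)
  also have "\<dots> \<le> (\<integral>\<^sup>+x. ennreal (\<Prod>i<n. g (x i)) * indicator T x \<partial>(\<Pi>\<^sub>M i\<in>{..<n}. \<nu>))"
    using le by (intro nn_integral_mono) (auto simp: indicator_def intro!: ennreal_leI)
  also have "\<dots> = emeasure (\<Pi>\<^sub>M i\<in>{..<n}. \<rho>) T"
    using T(2) by (simp add: PiM_\<rho>_eq_density emeasure_density)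
  finally show ?thesis .
qed

end

end

section \<open>The volume of a doubly typical stratum\<close>

theorem proposition3:
  fixes \<rho> :: "'a measure"
    and k :: nat
    and E :: "nat \<Rightarrow> 'a set"
    and \<mu>s :: "nat \<Rightarrow> 'a measure"
    and \<mu> :: "'a measure"
    and g :: "'a \<Rightarrow> real"
    and f :: "nat \<Rightarrow> 'a \<Rightarrow> real"
    and h :: "nat \<Rightarrow> real"
    and A :: "real \<Rightarrow> nat \<Rightarrow> (nat \<Rightarrow> nat) set"
    and \<delta> \<delta>' :: real
    and n :: nat
    and y :: "nat \<Rightarrow> nat"
  assumes "prob_space \<rho>"
    and "piecewise_continuous k E \<mu>s \<rho>"
    and "space \<rho> = (\<Union>i\<in>{1..k}. E i)"
    and "\<mu> = sum_measure \<rho> {1..k} \<mu>s"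
    and "density_version \<mu> \<rho> g"
    and "\<And>i. i \<in> {1..k} \<Longrightarrow> density_version (\<mu>s i) (piece_measure \<rho> E i) (f i)"
    and "density_version (count_space {1..k}) (index_distr k E \<rho>) h"
    and "finite_gen_entropy \<mu> g"
    and "\<And>d m. 0 < d \<Longrightarrow> 1 \<le> m \<Longrightarrow> A d m \<subseteq> typical_set (count_space {1..k}) h m d"
    and "\<And>d \<epsilon>. 0 < d \<Longrightarrow> 0 < \<epsilon> \<Longrightarrow>
           \<forall>\<^sub>F m in sequentially.
             measure (\<Pi>\<^sub>M i\<in>{..<m}. index_distr k E \<rho>) (A d m) \<ge> 1 - \<epsilon>"
    and "0 < \<delta>" and "0 < \<delta>'"
    and "1 \<le> n"
    and "y \<in> A \<delta>' n"
  shows "emeasure (\<Pi>\<^sub>M i\<in>{..<n}. \<mu>) (doubly_typical_stratum k E \<mu> g n \<delta> y)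
           \<le> ennreal (exp (real n * conditional_gen_entropy k E \<mu>s \<rho> f + real n * (\<delta> + \<delta>')))"
proof -
  interpret piecewise_continuous_prob \<rho> k E \<mu>s
    using assms(1-3) by (simp add: piecewise_continuous_prob_def piecewise_continuous_prob_axioms_def)
  have \<mu>: "\<mu> = \<nu>" using assms(4) by (simp add: \<nu>_def)
  have g: "density_version \<nu> \<rho> g" using assms(5) \<mu> by simp
  note h = density_version_index_distr[OF assms(7)]
  let ?T = "doubly_typical_stratum k E \<mu> g n \<delta> y"
  let ?HX = "gen_entropy \<nu> g" and ?HY = "gen_entropy (count_space {1..k}) h"
    and ?H = "conditional_gen_entropy k E \<mu>s \<rho> f"
  have chain: "?HX = ?HY + ?H"
    using assms(6-8) \<mu> by (intro entropy_chain_rule[OF g]) auto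
  have "y \<in> typical_set (count_space {1..k}) h n \<delta>'"
    using assms(9)[OF assms(12,13)] assms(14) by blast
  then have y: "\<And>i. i < n \<Longrightarrow> y i \<in> {1..k}" and pos: "0 < (\<Prod>i<n. h (y i))"
    and "?HY - \<delta>' \<le> - (1 / real n) * ln (\<Prod>i<n. h (y i))"
    by (auto simp: typical_set_def space_PiM PiE_iff abs_le_iff)
  then have "ln (\<Prod>i<n. h (y i)) \<le> - (real n * (?HY - \<delta>'))"
    using assms(13) by (simp add: field_simps)
  \<comment> \<open>The product of the \<open>h (y i)\<close> is the probability of the index word
    \<open>y\<close>; the lower side of the entropy estimate bounds it from above.\<close>
  then have hy: "(\<Prod>i<n. h (y i)) \<le> exp (- (real n * (?HY - \<delta>')))"
    using pos by (metis exp_le_cancel_iff exp_ln)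
  show ?thesis
  \<comment> \<open>Outside the \<sigma>-algebra \<open>emeasure\<close> is 0 by convention, so the
    bound is then trivial and measurability of the stratum need not be established.\<close>
  proof (cases "?T \<in> sets (\<Pi>\<^sub>M i\<in>{..<n}. \<mu>)")
    case True
    have "?T \<subseteq> (\<Pi>\<^sub>E i\<in>{..<n}. E (y i))"
    proof
      fix x assume "x \<in> ?T"
      then have x: "x \<in> (\<Pi>\<^sub>E i\<in>{..<n}. space \<rho>)" and "(\<lambda>i\<in>{..<n}. piece_index k E (x i)) = y"
        by (auto simp: doubly_typical_stratum_def space_PiM \<mu>)
      then have "\<And>i. i < n \<Longrightarrow> y i = piece_index k E (x i)" by auto
      then show "x \<in> (\<Pi>\<^sub>E i\<in>{..<n}. E (y i))"
        using x piece_index_in(2) by (auto simp: PiE_iff)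
    qed
    moreover have "(\<Pi>\<^sub>E i\<in>{..<n}. E (y i)) \<in> sets (\<Pi>\<^sub>M i\<in>{..<n}. \<rho>)"
      using y sets_E by (intro sets_PiM_I_finite) auto
    ultimately have "emeasure (\<Pi>\<^sub>M i\<in>{..<n}. \<rho>) ?T
      \<le> emeasure (\<Pi>\<^sub>M i\<in>{..<n}. \<rho>) (\<Pi>\<^sub>E i\<in>{..<n}. E (y i))"
      by (intro emeasure_mono)
    also have "\<dots> = (\<Prod>i<n. emeasure \<rho> (E (y i)))"
    proof -
      interpret product_sigma_finite "\<lambda>_::nat. \<rho>" by standard
      show ?thesis using y sets_E by (intro emeasure_PiM) auto
    qed
    also have "\<dots> = ennreal (\<Prod>i<n. h (y i))"
      using y by (simp add: h emeasure_eq_measure prod_ennreal)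
    also have "\<dots> \<le> ennreal (exp (- (real n * (?HY - \<delta>'))))"
      using hy by (rule ennreal_leI)
    finally have up: "emeasure (\<Pi>\<^sub>M i\<in>{..<n}. \<rho>) ?T \<le> ennreal (exp (- (real n * (?HY - \<delta>'))))" .
    let ?c = "real n * (?HX + \<delta>)"
    have low: "ennreal (exp (- ?c)) * emeasure (\<Pi>\<^sub>M i\<in>{..<n}. \<mu>) ?T \<le> emeasure (\<Pi>\<^sub>M i\<in>{..<n}. \<rho>) ?T"
      using True assms(13) unfolding \<mu>
      by (intro emeasure_typical_le[OF g]) (auto simp: doubly_typical_stratum_def)
    \<comment> \<open>The volume may be infinite a priori, so the lower bound is not divided out;
      instead the factor \<open>exp ?c * exp (- ?c) = 1\<close> is inserted.\<close>
    have "emeasure (\<Pi>\<^sub>M i\<in>{..<n}. \<mu>) ?T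
      = ennreal (exp ?c) * (ennreal (exp (- ?c)) * emeasure (\<Pi>\<^sub>M i\<in>{..<n}. \<mu>) ?T)"
      by (simp flip: mult.assoc ennreal_mult exp_add)
    also have "\<dots> \<le> ennreal (exp ?c) * ennreal (exp (- (real n * (?HY - \<delta>'))))"
      using low up by (intro mult_left_mono) auto
    \<comment> \<open>By the chain rule \<open>?HX - ?HY\<close> is \<open>?H\<close>, while the two
      tolerances add up.\<close>
    also have "\<dots> = ennreal (exp (real n * ?H + real n * (\<delta> + \<delta>')))"
      by (simp add: chain algebra_simps flip: ennreal_mult exp_add)
    finally show ?thesis .
  qed (simp add: emeasure_notin_sets)
qed

end
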